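(* Let $E\subset\mathbb{R}^n$ be open, let $L$ be a continuous vector field on $E$, let $q:E\to\mathbb{R}$ be continuous, and let $\eta\in C^1(E)$ have no zeros in $E$ and satisfy $(L+q)\eta=0$. Then the operator equality $\eta L\eta^{-1}=L+q$ on $C^1(E)$ is equivalent to the operator equality $$L=\eta^{-1}(L+q)\eta \quad\text{on } C^1(E),$$ and the latter holds. Consequently all operators of this form based on the same field $L$ can be transformed to $L$ and to each other: if $q_1,q_2\in C^0(E)$ and $\eta_1,\eta_2\in C^1(E)$ have no zeros in $E$ and satisfy $(L+q_i)\eta_i=0$ for $i=1,2$, then $L=\eta_i^{-1}(L+q_i)\eta_i$ for $i=1,2$ and $$L+q_2=\eta_2\eta_1^{-1}(L+q_1)\eta_1\eta_2^{-1}\quad\text{on } C^1(E).$$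
   Context: A continuous vector field $L=\sum_{k=1}^n a_k\,\partial/\partial x_k$ ($a_k\in C^0(E)$) is regarded as the operator $C^1(E)\to C^0(E)$, $\psi\mapsto L\psi=\sum_k a_k\,\partial\psi/\partial x_k$. The operator $L+q:C^1(E)\to C^0(E)$ is $(L+q)\psi=L\psi+q\psi$. A scalar function appearing as a factor in an operator product denotes multiplication by that function, and products are compositions; $\eta^{-1}=1/\eta$. *)

theory Defs
  imports "HOL-Analysis.Analysis"
begin

text \<open>
  Functions on an open set E are represented by total functions of which only the values on E
  matter: equality of functions on E is pointwise equality on E, and since E is open the
  partial derivatives at points of E depend only on the values on E.
\<close>

definition partial_deriv :: "'n::finite \<Rightarrow> (real ^ 'n \<Rightarrow> real) \<Rightarrow> real ^ 'n \<Rightarrow> real" where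
  "partial_deriv k f x = deriv (\<lambda>t. f (x + t *\<^sub>R axis k 1)) 0"

definition C0 :: "(real ^ 'n::finite) set \<Rightarrow> (real ^ 'n \<Rightarrow> real) set" where
  "C0 E = {f. continuous_on E f}"

text \<open>
  The existence of the partial derivatives has to be required separately because
  \<^term>\<open>deriv\<close> is a total function.
\<close>

definition C1 :: "(real ^ 'n::finite) set \<Rightarrow> (real ^ 'n \<Rightarrow> real) set" where
  "C1 E = {f \<in> C0 E. \<forall>k.
     (\<forall>x\<in>E. (\<lambda>t. f (x + t *\<^sub>R axis k 1)) field_differentiable (at 0)) \<and>
     partial_deriv k f \<in> C0 E}"

type_synonym 'n operator = "(real ^ 'n \<Rightarrow> real) \<Rightarrow> (real ^ 'n \<Rightarrow> real)"

definition vector_field :: "('n::finite \<Rightarrow> real ^ 'n \<Rightarrow> real) \<Rightarrow> 'n operator" where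
  "vector_field a \<psi> = (\<lambda>x. \<Sum>k\<in>UNIV. a k x * partial_deriv k \<psi> x)"

definition continuous_vector_field :: "(real ^ 'n::finite) set \<Rightarrow> 'n operator \<Rightarrow> bool" where
  "continuous_vector_field E L \<longleftrightarrow> (\<exists>a. (\<forall>k. a k \<in> C0 E) \<and> L = vector_field a)"

definition mult_op :: "(real ^ 'n::finite \<Rightarrow> real) \<Rightarrow> 'n operator" where
  "mult_op g \<psi> = (\<lambda>x. g x * \<psi> x)"

definition add_potential ::
  "'n::finite operator \<Rightarrow> (real ^ 'n \<Rightarrow> real) \<Rightarrow> 'n operator" where
  "add_potential L q \<psi> = (\<lambda>x. L \<psi> x + q x * \<psi> x)"

definition op_eq_on :: "(real ^ 'n::finite) set \<Rightarrow> 'n operator \<Rightarrow> 'n operator \<Rightarrow> bool" where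
  "op_eq_on E A B \<longleftrightarrow> (\<forall>\<psi>\<in>C1 E. \<forall>x\<in>E. A \<psi> x = B \<psi> x)"

text \<open>
  The following facts show that the compositions of these operators are well defined:
  multiplication by a function in \<^term>\<open>C1 E\<close> or by the reciprocal of a zero-free one maps
  \<^term>\<open>C1 E\<close> into itself, and \<^term>\<open>add_potential L q\<close> maps \<^term>\<open>C1 E\<close> to \<^term>\<open>C0 E\<close>.
  The values of these operators on E are determined by the values of their arguments on E.
\<close>

lemma C1_D:
  assumes "f \<in> C1 E"
  shows "continuous_on E f" "continuous_on E (partial_deriv k f)"
    "x \<in> E \<Longrightarrow> ((\<lambda>t. f (x + t *\<^sub>R axis k 1)) has_field_derivative partial_deriv k f x) (at 0)"
  using assms by (auto simp: C1_def C0_def partial_deriv_def DERIV_deriv_iff_field_differentiable)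

lemma C1_I:
  assumes "continuous_on E f" "\<And>k. continuous_on E (f' k)"
    "\<And>k x. x \<in> E \<Longrightarrow> ((\<lambda>t. f (x + t *\<^sub>R axis k 1)) has_field_derivative f' k x) (at 0)"
  shows "f \<in> C1 E"
proof -
  have eq: "partial_deriv k f x = f' k x" if "x \<in> E" for k x
    unfolding partial_deriv_def by (rule DERIV_imp_deriv[OF assms(3)[OF that]])
  have "continuous_on E (partial_deriv k f)" for k
    using assms(2)[of k] eq by (subst continuous_on_cong[OF refl, of E _ "f' k"]) auto
  moreover have "(\<lambda>t. f (x + t *\<^sub>R axis k 1)) field_differentiable (at 0)" if "x \<in> E" for k x
    using assms(3)[OF that] by (auto simp: field_differentiable_def)
  ultimately show ?thesis
    using assms(1) by (auto simp: C1_def C0_def)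
qed

lemma mult_op_C1:
  assumes "g \<in> C1 E" "\<psi> \<in> C1 E"
  shows "mult_op g \<psi> \<in> C1 E"
  unfolding mult_op_def
proof (rule C1_I[where f' = "\<lambda>k x. partial_deriv k g x * \<psi> x + partial_deriv k \<psi> x * g x"])
  show "((\<lambda>t. g (x + t *\<^sub>R axis k 1) * \<psi> (x + t *\<^sub>R axis k 1)) has_field_derivative
      partial_deriv k g x * \<psi> x + partial_deriv k \<psi> x * g x) (at 0)" if "x \<in> E" for k x
    using DERIV_mult[OF C1_D(3)[OF assms(1) that, of k] C1_D(3)[OF assms(2) that, of k]] by simp
qed (intro continuous_intros C1_D assms)+

lemma reciprocal_C1:
  assumes "g \<in> C1 E" "\<And>x. x \<in> E \<Longrightarrow> g x \<noteq> 0"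
  shows "(\<lambda>x. 1 / g x) \<in> C1 E"
proof (rule C1_I[where f' = "\<lambda>k x. - partial_deriv k g x / (g x)\<^sup>2"])
  show "((\<lambda>t. 1 / g (x + t *\<^sub>R axis k 1)) has_field_derivative
      - partial_deriv k g x / (g x)\<^sup>2) (at 0)" if "x \<in> E" for k x
    using DERIV_divide[OF DERIV_const C1_D(3)[OF assms(1) that, of k], of 1] assms(2)[OF that]
    by (simp add: power2_eq_square)
qed (use assms in \<open>auto intro!: continuous_intros C1_D(1,2)[OF assms(1)]\<close>)

lemma add_potential_C0:
  assumes "continuous_vector_field E L" "q \<in> C0 E" "\<psi> \<in> C1 E"
  shows "add_potential L q \<psi> \<in> C0 E"
proof -
  obtain a where a: "\<And>k. continuous_on E (a k)" "L = vector_field a"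
    using assms(1) by (auto simp: continuous_vector_field_def C0_def)
  have q: "continuous_on E q" using assms(2) by (simp add: C0_def)
  show ?thesis
    unfolding C0_def add_potential_def a(2) vector_field_def mem_Collect_eq
    by (intro continuous_intros C1_D[OF assms(3)] a(1) q)
qed

lemma add_potential_cong:
  assumes "open E" "continuous_vector_field E L" "\<And>y. y \<in> E \<Longrightarrow> \<phi> y = \<psi> y" "x \<in> E"
  shows "add_potential L q \<phi> x = add_potential L q \<psi> x"
proof -
  have "partial_deriv k \<phi> x = partial_deriv k \<psi> x" for k
    unfolding partial_deriv_def
  proof (rule deriv_cong_ev[OF _ refl])
    have "((\<lambda>t. x + t *\<^sub>R axis k 1) \<longlongrightarrow> x + 0 *\<^sub>R axis k 1) (nhds (0::real))"
      by (intro tendsto_intros filterlim_ident)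
    then have "\<forall>\<^sub>F t in nhds (0::real). x + t *\<^sub>R axis k 1 \<in> E"
      by (rule topological_tendstoD) (use assms in auto)
    then show "\<forall>\<^sub>F t in nhds 0. \<phi> (x + t *\<^sub>R axis k 1) = \<psi> (x + t *\<^sub>R axis k 1)"
      by eventually_elim (rule assms(3))
  qed
  then show ?thesis
    using assms by (auto simp: continuous_vector_field_def add_potential_def vector_field_def)
qed

end

theory Submission
  imports Defs
begin

text \<open>
  A vector field is a derivation, so for \<open>\<eta>\<close> and \<open>\<psi>\<close> in \<open>C1 E\<close> the Leibniz rule gives
  \<open>(L + q)(\<eta>\<psi>) = \<eta> L\<psi> + \<psi> (L + q)\<eta>\<close> (\<open>add_potential_mult_op\<close>). When \<open>(L + q)\<eta> = 0\<close> this
  says that multiplication by \<open>\<eta>\<close> intertwines \<open>L\<close> with \<open>L + q\<close>, and dividing by the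
  zero-free \<open>\<eta>\<close> gives \<open>L = \<eta>\<inverse>(L + q)\<eta>\<close>.

  The other form, \<open>\<eta>L\<eta>\<inverse> = L + q\<close>, is the same identity after the substitution
  \<open>\<psi> \<mapsto> \<eta>\<inverse>\<psi>\<close>, a bijection of \<open>C1 E\<close>. Functions here are total and \<open>\<eta>\<eta>\<inverse>\<psi>\<close>
  agrees with \<open>\<psi>\<close> only on \<open>E\<close>, so the substitution is legitimate only for operators whose
  values on \<open>E\<close> are determined by the values of the argument on \<open>E\<close>
  (\<open>op_eq_on_conjugation_iff\<close>); for first-order operators this is where openness of \<open>E\<close> enters.
  Conjugating from \<open>L + q\<^sub>2\<close> to \<open>L\<close> and then to \<open>L + q\<^sub>1\<close> relates any two such operators.
\<close>

lemma partial_deriv_mult_op: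
  assumes "f \<in> C1 E" "g \<in> C1 E" "x \<in> E"
  shows "partial_deriv k (mult_op f g) x = partial_deriv k f x * g x + f x * partial_deriv k g x"
  using DERIV_imp_deriv[OF DERIV_mult[OF C1_D(3)[OF assms(1,3), of k] C1_D(3)[OF assms(2,3), of k]]]
  unfolding partial_deriv_def[of k "mult_op f g"] by (simp add: mult_op_def mult.commute)

lemma vector_field_mult_op:
  assumes "f \<in> C1 E" "g \<in> C1 E" "x \<in> E"
  shows "vector_field a (mult_op f g) x = f x * vector_field a g x + g x * vector_field a f x"
  unfolding vector_field_def partial_deriv_mult_op[OF assms]
  by (simp add: algebra_simps sum.distrib sum_distrib_left)

text \<open>
  The potential term is attached to only one of the two factors, because
  \<open>q \<cdot> f \<cdot> g\<close> occurs just once on the left. This asymmetry is what lets a solution of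
  \<open>(L + q) f = 0\<close> remove the potential.
\<close>
lemma add_potential_mult_op:
  assumes "continuous_vector_field E L" "f \<in> C1 E" "g \<in> C1 E" "x \<in> E"
  shows "add_potential L q (mult_op f g) x = f x * L g x + g x * add_potential L q f x"
proof -
  obtain a where "L = vector_field a"
    using assms(1) by (auto simp: continuous_vector_field_def)
  then show ?thesis
    using vector_field_mult_op[OF assms(2-4), of a]
    by (simp add: add_potential_def mult_op_def algebra_simps)
qed

lemma continuous_vector_field_cong:
  assumes "open E" "continuous_vector_field E L" "\<And>y. y \<in> E \<Longrightarrow> \<phi> y = \<psi> y" "x \<in> E"
  shows "L \<phi> x = L \<psi> x"
  using add_potential_cong[OF assms, where q = "\<lambda>_. 0"] by (simp add: add_potential_def)

text \<open>
  Conjugation by a zero-free function is invertible: each equality is the other one applied to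
  \<open>\<eta>\<psi>\<close> or \<open>\<psi>/\<eta>\<close>. The two congruence assumptions let \<open>\<eta> \<cdot> (\<psi>/\<eta>)\<close> be replaced by \<open>\<psi>\<close>
  although the two may differ outside \<open>E\<close>.
\<close>
lemma op_eq_on_conjugation_iff:
  assumes \<eta>: "\<eta> \<in> C1 E" "\<And>x. x \<in> E \<Longrightarrow> \<eta> x \<noteq> 0"
    and A_cong: "\<And>\<phi> \<psi> x. (\<And>y. y \<in> E \<Longrightarrow> \<phi> y = \<psi> y) \<Longrightarrow> x \<in> E \<Longrightarrow> A \<phi> x = A \<psi> x"
    and B_cong: "\<And>\<phi> \<psi> x. (\<And>y. y \<in> E \<Longrightarrow> \<phi> y = \<psi> y) \<Longrightarrow> x \<in> E \<Longrightarrow> B \<phi> x = B \<psi> x"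
  shows "op_eq_on E (mult_op \<eta> \<circ> A \<circ> mult_op (\<lambda>x. 1 / \<eta> x)) B \<longleftrightarrow>
    op_eq_on E A (mult_op (\<lambda>x. 1 / \<eta> x) \<circ> B \<circ> mult_op \<eta>)"
proof
  assume eq: "op_eq_on E (mult_op \<eta> \<circ> A \<circ> mult_op (\<lambda>x. 1 / \<eta> x)) B"
  show "op_eq_on E A (mult_op (\<lambda>x. 1 / \<eta> x) \<circ> B \<circ> mult_op \<eta>)"
    unfolding op_eq_on_def
  proof (intro ballI)
    fix \<psi> x assume \<psi>: "\<psi> \<in> C1 E" and x: "x \<in> E"
    have "\<eta> x * A (mult_op (\<lambda>x. 1 / \<eta> x) (mult_op \<eta> \<psi>)) x = B (mult_op \<eta> \<psi>) x"
      using eq mult_op_C1[OF \<eta>(1) \<psi>] x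
      unfolding op_eq_on_def comp_apply mult_op_def[of \<eta> "A _"] by blast
    moreover have "A (mult_op (\<lambda>x. 1 / \<eta> x) (mult_op \<eta> \<psi>)) x = A \<psi> x"
      by (rule A_cong[OF _ x]) (simp add: mult_op_def \<eta>(2))
    ultimately show "A \<psi> x = (mult_op (\<lambda>x. 1 / \<eta> x) \<circ> B \<circ> mult_op \<eta>) \<psi> x"
      using \<eta>(2)[OF x] by (simp add: mult_op_def[of "\<lambda>x. 1 / \<eta> x" "B _"] field_simps)
  qed
next
  assume eq: "op_eq_on E A (mult_op (\<lambda>x. 1 / \<eta> x) \<circ> B \<circ> mult_op \<eta>)"
  show "op_eq_on E (mult_op \<eta> \<circ> A \<circ> mult_op (\<lambda>x. 1 / \<eta> x)) B"
    unfolding op_eq_on_def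
  proof (intro ballI)
    fix \<psi> x assume \<psi>: "\<psi> \<in> C1 E" and x: "x \<in> E"
    let ?\<phi> = "mult_op (\<lambda>x. 1 / \<eta> x) \<psi>"
    have "?\<phi> \<in> C1 E"
      by (rule mult_op_C1[OF reciprocal_C1[OF \<eta>] \<psi>])
    then have "A ?\<phi> x = 1 / \<eta> x * B (mult_op \<eta> ?\<phi>) x"
      using eq x unfolding op_eq_on_def comp_apply mult_op_def[of "\<lambda>x. 1 / \<eta> x" "B _"] by blast
    moreover have "B (mult_op \<eta> ?\<phi>) x = B \<psi> x"
      by (rule B_cong[OF _ x]) (simp add: mult_op_def \<eta>(2))
    ultimately show "(mult_op \<eta> \<circ> A \<circ> mult_op (\<lambda>x. 1 / \<eta> x)) \<psi> x = B \<psi> x"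
      using \<eta>(2)[OF x] by (simp add: mult_op_def[of \<eta> "A _"])
  qed
qed

lemma conjugation_removes_potential:
  assumes "continuous_vector_field E L" "\<eta> \<in> C1 E" "\<And>x. x \<in> E \<Longrightarrow> \<eta> x \<noteq> 0"
    and "\<And>x. x \<in> E \<Longrightarrow> add_potential L q \<eta> x = 0"
  shows "op_eq_on E L (mult_op (\<lambda>x. 1 / \<eta> x) \<circ> add_potential L q \<circ> mult_op \<eta>)"
  unfolding op_eq_on_def
proof (intro ballI)
  fix \<psi> x assume \<psi>: "\<psi> \<in> C1 E" and x: "x \<in> E"
  have "add_potential L q (mult_op \<eta> \<psi>) x = \<eta> x * L \<psi> x"
    using add_potential_mult_op[OF assms(1,2) \<psi> x] assms(4)[OF x] by simp
  then show "L \<psi> x = (mult_op (\<lambda>x. 1 / \<eta> x) \<circ> add_potential L q \<circ> mult_op \<eta>) \<psi> x"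
    using assms(3)[OF x] by (simp add: mult_op_def[of "\<lambda>x. 1 / \<eta> x" "add_potential _ _ _"])
qed

lemma conjugation_iff_add_potential:
  assumes "open E" "continuous_vector_field E L" "\<eta> \<in> C1 E" "\<And>x. x \<in> E \<Longrightarrow> \<eta> x \<noteq> 0"
  shows "op_eq_on E (mult_op \<eta> \<circ> L \<circ> mult_op (\<lambda>x. 1 / \<eta> x)) (add_potential L q) \<longleftrightarrow>
    op_eq_on E L (mult_op (\<lambda>x. 1 / \<eta> x) \<circ> add_potential L q \<circ> mult_op \<eta>)"
  by (rule op_eq_on_conjugation_iff[OF assms(3,4)
        continuous_vector_field_cong[OF assms(1,2)] add_potential_cong[OF assms(1,2)]])

text \<open>
  The field \<open>L\<close> is the common intermediate form:
  \<open>L + q\<^sub>2 = \<eta>\<^sub>2 L \<eta>\<^sub>2\<inverse>\<close>, and here \<open>L\<close> is replaced by \<open>\<eta>\<^sub>1\<inverse>(L + q\<^sub>1)\<eta>\<^sub>1\<close>.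
\<close>
lemma conjugation_changes_potential:
  assumes "open E" "continuous_vector_field E L"
    and \<eta>\<^sub>1: "\<eta>\<^sub>1 \<in> C1 E" "\<And>x. x \<in> E \<Longrightarrow> \<eta>\<^sub>1 x \<noteq> 0" "\<And>x. x \<in> E \<Longrightarrow> add_potential L q\<^sub>1 \<eta>\<^sub>1 x = 0"
    and \<eta>\<^sub>2: "\<eta>\<^sub>2 \<in> C1 E" "\<And>x. x \<in> E \<Longrightarrow> \<eta>\<^sub>2 x \<noteq> 0" "\<And>x. x \<in> E \<Longrightarrow> add_potential L q\<^sub>2 \<eta>\<^sub>2 x = 0"
  shows "op_eq_on E (add_potential L q\<^sub>2)
    (mult_op \<eta>\<^sub>2 \<circ> mult_op (\<lambda>x. 1 / \<eta>\<^sub>1 x) \<circ> add_potential L q\<^sub>1 \<circ>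
     mult_op \<eta>\<^sub>1 \<circ> mult_op (\<lambda>x. 1 / \<eta>\<^sub>2 x))"
  unfolding op_eq_on_def
proof (intro ballI)
  fix \<psi> x assume \<psi>: "\<psi> \<in> C1 E" and x: "x \<in> E"
  let ?\<phi> = "mult_op (\<lambda>x. 1 / \<eta>\<^sub>2 x) \<psi>"
  have "op_eq_on E (mult_op \<eta>\<^sub>2 \<circ> L \<circ> mult_op (\<lambda>x. 1 / \<eta>\<^sub>2 x)) (add_potential L q\<^sub>2)"
    using conjugation_iff_add_potential[OF assms(1,2) \<eta>\<^sub>2(1,2)]
      conjugation_removes_potential[OF assms(2) \<eta>\<^sub>2] by blast
  then have "add_potential L q\<^sub>2 \<psi> x = \<eta>\<^sub>2 x * L ?\<phi> x"
    using \<psi> x by (simp add: op_eq_on_def mult_op_def[of \<eta>\<^sub>2 "L _"])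
  also have "L ?\<phi> x = (mult_op (\<lambda>x. 1 / \<eta>\<^sub>1 x) \<circ> add_potential L q\<^sub>1 \<circ> mult_op \<eta>\<^sub>1) ?\<phi> x"
    using conjugation_removes_potential[OF assms(2) \<eta>\<^sub>1]
      mult_op_C1[OF reciprocal_C1[OF \<eta>\<^sub>2(1,2)] \<psi>] x
    unfolding op_eq_on_def by blast
  finally show "add_potential L q\<^sub>2 \<psi> x = (mult_op \<eta>\<^sub>2 \<circ> mult_op (\<lambda>x. 1 / \<eta>\<^sub>1 x) \<circ>
      add_potential L q\<^sub>1 \<circ> mult_op \<eta>\<^sub>1 \<circ> mult_op (\<lambda>x. 1 / \<eta>\<^sub>2 x)) \<psi> x"
    by (simp add: mult_op_def[of \<eta>\<^sub>2 "mult_op _ (add_potential _ _ _)"])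
qed

theorem corollary1:
  fixes E :: "(real ^ 'n::finite) set"
    and L :: "'n operator"
  assumes "open E"
    and "continuous_vector_field E L"
  shows "(\<forall>q \<eta>.
            q \<in> C0 E \<and> \<eta> \<in> C1 E \<and> (\<forall>x\<in>E. \<eta> x \<noteq> 0) \<and> (\<forall>x\<in>E. add_potential L q \<eta> x = 0) \<longrightarrow>
            (op_eq_on E (mult_op \<eta> \<circ> L \<circ> mult_op (\<lambda>x. 1 / \<eta> x)) (add_potential L q) \<longleftrightarrow>
             op_eq_on E L (mult_op (\<lambda>x. 1 / \<eta> x) \<circ> add_potential L q \<circ> mult_op \<eta>)) \<and>
            op_eq_on E L (mult_op (\<lambda>x. 1 / \<eta> x) \<circ> add_potential L q \<circ> mult_op \<eta>)) \<and>
         (\<forall>q\<^sub>1 q\<^sub>2 \<eta>\<^sub>1 \<eta>\<^sub>2.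
            q\<^sub>1 \<in> C0 E \<and> q\<^sub>2 \<in> C0 E \<and> \<eta>\<^sub>1 \<in> C1 E \<and> \<eta>\<^sub>2 \<in> C1 E \<and>
            (\<forall>x\<in>E. \<eta>\<^sub>1 x \<noteq> 0) \<and> (\<forall>x\<in>E. \<eta>\<^sub>2 x \<noteq> 0) \<and>
            (\<forall>x\<in>E. add_potential L q\<^sub>1 \<eta>\<^sub>1 x = 0) \<and> (\<forall>x\<in>E. add_potential L q\<^sub>2 \<eta>\<^sub>2 x = 0) \<longrightarrow>
            op_eq_on E L (mult_op (\<lambda>x. 1 / \<eta>\<^sub>1 x) \<circ> add_potential L q\<^sub>1 \<circ> mult_op \<eta>\<^sub>1) \<and>
            op_eq_on E L (mult_op (\<lambda>x. 1 / \<eta>\<^sub>2 x) \<circ> add_potential L q\<^sub>2 \<circ> mult_op \<eta>\<^sub>2) \<and>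
            op_eq_on E (add_potential L q\<^sub>2)
              (mult_op \<eta>\<^sub>2 \<circ> mult_op (\<lambda>x. 1 / \<eta>\<^sub>1 x) \<circ> add_potential L q\<^sub>1 \<circ>
               mult_op \<eta>\<^sub>1 \<circ> mult_op (\<lambda>x. 1 / \<eta>\<^sub>2 x)))"
  by (intro conjI allI impI; elim conjE; (rule conjugation_iff_add_potential
    conjugation_removes_potential conjugation_changes_potential; use assms in blast))

end
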